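(* For every positive integer $n$, $\tilde{R}(\dot C^{(rbr)}_{2},Q_n)=\tilde{R}(\dot C^{(rbr)}_{3},Q_n)=2n$. For every $t\ge 4$ and all sufficiently large $n$, $$2.24n< \tilde{R}(\dot C^{(rbr)}_{t},Q_n)\le (t-1)n.$$
   Context: $\dot C_t^{(rbr)}$ denotes the chain on $t$ vertices colored alternately red and blue, with red minimal vertex. $Q_N$ is the Boolean lattice of all subsets of an $N$-element set ordered by inclusion. In a blue/red coloring of $Q_N$, a copy of a colored poset $\dot P$ is an induced subposet isomorphic to $P$ whose vertices have the colors of the corresponding vertices of $\dot P$. The poset Erdős–Hajnal number $\tilde{R}(\dot P,Q_n)$ is the minimum $N$ such that every blue/red coloring of $Q_N$ contains a copy of $\dot P$ or a monochromatic induced copy of $Q_n$. *)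

theory Defs
  imports Complex_Main
begin

text \<open>Colors: True = red, False = blue. A blue/red coloring of Q_N is a map
  c :: nat set \<Rightarrow> bool, of which only the values on Pow {0..<N} matter.\<close>

definition has_copy ::
  "'a set \<Rightarrow> ('a \<Rightarrow> 'a \<Rightarrow> bool) \<Rightarrow> ('a \<Rightarrow> bool) \<Rightarrow> (nat set \<Rightarrow> bool) \<Rightarrow> nat \<Rightarrow> bool" where
  "has_copy P le col c N \<longleftrightarrow>
     (\<exists>f. inj_on f P \<and> f ` P \<subseteq> Pow {0..<N}
        \<and> (\<forall>a\<in>P. \<forall>b\<in>P. (f a \<subseteq> f b \<longleftrightarrow> le a b))
        \<and> (\<forall>a\<in>P. c (f a) = col a))"

definition has_rbr_chain :: "nat \<Rightarrow> (nat set \<Rightarrow> bool) \<Rightarrow> nat \<Rightarrow> bool" where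
  "has_rbr_chain t c N \<longleftrightarrow> has_copy {0..<t} (\<le>) (\<lambda>i. even i) c N"

definition has_mono_Q :: "nat \<Rightarrow> (nat set \<Rightarrow> bool) \<Rightarrow> nat \<Rightarrow> bool" where
  "has_mono_Q n c N \<longleftrightarrow>
     (\<exists>col::bool. has_copy (Pow {0..<n}) (\<subseteq>) (\<lambda>_. col) c N)"

definition EH_chain :: "nat \<Rightarrow> nat \<Rightarrow> nat" where
  "EH_chain t n = (LEAST N. \<forall>c :: nat set \<Rightarrow> bool. has_rbr_chain t c N \<or> has_mono_Q n c N)"

end

theory Submission
  imports Defs "HOL-Library.FuncSet" "HOL-Library.Disjoint_Sets" "HOL-Real_Asymp.Real_Asymp"
begin

text \<open>Upper bound, in the form \<open>(t div 2 + 1) * n\<close>. Without an alternating chain of length \<open>t\<close> the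
  length \<open>h S\<close> of the longest alternating chain below \<open>S\<close> is a monotone map into \<open>{0..<t}\<close> whose
  parity is the color of \<open>S\<close>. Greedily lifting the subsets of an \<open>n\<close>-set \<open>X\<close> along an ordering of its
  complement either gives a blue copy of \<open>Q_n\<close> or a red chain that adds the complement point by point.
  On such a chain \<open>h\<close> takes at most \<open>t div 2\<close> values, hence is constant while \<open>n\<close> consecutive points
  are added, and these points span a red copy.

  Lower bound for \<open>t \<ge> 4\<close>. Put \<open>N = \<lfloor>2.24 n\<rfloor>\<close>, \<open>M = N - n\<close>, \<open>l \<approx> 0.495 n\<close>, \<open>k = n - l\<close>. Color the sets of size
  less than \<open>k\<close> blue, those of size more than \<open>N - k\<close> red, and those in between red iff they lie below
  a member of a random family \<open>\<H>\<close> of \<open>M\<close>-sets. Every copy of \<open>Q_n\<close> maps \<open>A \<subseteq> X\<close> to a set with trace \<open>A\<close> on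
  some \<open>n\<close>-set \<open>X\<close>. There are no blue copies if for all disjoint \<open>X\<close>, \<open>W\<close> of sizes \<open>n\<close>, \<open>M - k\<close> some
  \<open>F \<union> W\<close> with \<open>F\<close> a \<open>k\<close>-subset of \<open>X\<close> is in \<open>\<H>\<close>; there are no red copies if for all disjoint \<open>X\<close>, \<open>F\<close> of sizes
  \<open>n\<close>, \<open>k\<close> some \<open>F \<union> B\<close> with \<open>B\<close> an \<open>l\<close>-subset of \<open>X\<close> is below no member of \<open>\<H>\<close>. The first condition holds with
  about \<open>N * (N choose M) / (n choose l)\<close> samples, and then a given \<open>F \<union> B\<close> is covered with
  probability at most \<open>4 powr (- 0.05 n)\<close>. Fifty sets \<open>B\<close> with pairwise intersections about \<open>n / 4\<close> suffice
  for the union bound: no \<open>M\<close>-set contains two of the sets \<open>F \<union> B\<close>, so they are covered by distinct samples.\<close>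

section \<open>Copies of Boolean lattices\<close>

lemma has_copy_mono:
  assumes "has_copy P le col c N" "N \<le> N'"
  shows "has_copy P le col c N'"
proof -
  have "Pow {0..<N} \<subseteq> Pow {0..<N'}" using assms(2) by auto
  then show ?thesis using assms(1) unfolding has_copy_def by (meson order_trans)
qed

lemma has_mono_Q_mono: "has_mono_Q n c N \<Longrightarrow> N \<le> N' \<Longrightarrow> has_mono_Q n c N'"
  unfolding has_mono_Q_def using has_copy_mono by blast

lemma has_rbr_chain_mono: "has_rbr_chain t c N \<Longrightarrow> N \<le> N' \<Longrightarrow> has_rbr_chain t c N'"
  unfolding has_rbr_chain_def using has_copy_mono by blast

lemma has_rbr_chain_shorter:
  assumes "has_rbr_chain t c N" "s \<le> t"
  shows "has_rbr_chain s c N"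
proof -
  have sub: "{0..<s} \<subseteq> {0..<t}" using assms(2) by auto
  obtain f where f: "inj_on f {0..<t}" "f ` {0..<t} \<subseteq> Pow {0..<N}"
    "\<forall>a\<in>{0..<t}. \<forall>b\<in>{0..<t}. (f a \<subseteq> f b) = (a \<le> b)" "\<forall>a\<in>{0..<t}. c (f a) = even a"
    using assms(1) unfolding has_rbr_chain_def has_copy_def by blast
  show ?thesis unfolding has_rbr_chain_def has_copy_def
    by (intro exI[of _ f] conjI inj_on_subset[OF f(1) sub] order_trans[OF image_mono[OF sub] f(2)])
      (use f(3,4) sub in blast)+
qed

lemma rbr_chainE:
  assumes "has_rbr_chain t c N"
  obtains f where "\<And>i. i < t \<Longrightarrow> f i \<subseteq> {0..<N}" "\<And>i j. i \<le> j \<Longrightarrow> j < t \<Longrightarrow> f i \<subseteq> f j"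
    "\<And>i. i < t \<Longrightarrow> c (f i) = even i"
proof -
  obtain f where f: "inj_on f {0..<t}" "f ` {0..<t} \<subseteq> Pow {0..<N}"
    "\<forall>a\<in>{0..<t}. \<forall>b\<in>{0..<t}. (f a \<subseteq> f b) = (a \<le> b)" "\<forall>a\<in>{0..<t}. c (f a) = even a"
    using assms unfolding has_rbr_chain_def has_copy_def by blast
  have "f i \<subseteq> {0..<N}" if "i < t" for i using f(2) that by (auto simp: image_subset_iff)
  then show ?thesis by (rule that[of f]) (use f in auto)
qed

text \<open>From an embedding \<open>f\<close>, choose for each \<open>i\<close> a point
  \<open>x i\<close> of \<open>f {i}\<close> outside \<open>f ({0..<n} - {i})\<close>, which exists
  since \<open>f\<close> reflects the order. Monotonicity gives \<open>x i \<in> f A\<close> iff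
  \<open>i \<in> A\<close>, so these points form \<open>X\<close>.\<close>

lemma mono_Q_witness:
  assumes "has_mono_Q n c N"
  obtains X \<psi> col where "X \<subseteq> {0..<N}" "card X = n"
    "\<And>A. A \<subseteq> X \<Longrightarrow> \<psi> A \<subseteq> {0..<N}" "\<And>A. A \<subseteq> X \<Longrightarrow> \<psi> A \<inter> X = A"
    "\<And>A. A \<subseteq> X \<Longrightarrow> c (\<psi> A) = col"
    "\<And>A B. A \<subseteq> B \<Longrightarrow> B \<subseteq> X \<Longrightarrow> \<psi> A \<subseteq> \<psi> B"
proof -
  obtain col f where f: "f ` Pow {0..<n} \<subseteq> Pow {0..<N}"
    and le: "\<And>a b. a \<subseteq> {0..<n} \<Longrightarrow> b \<subseteq> {0..<n} \<Longrightarrow> (f a \<subseteq> f b) = (a \<subseteq> b)"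
    and col: "\<And>a. a \<subseteq> {0..<n} \<Longrightarrow> c (f a) = col"
    using assms unfolding has_mono_Q_def has_copy_def by auto
  have fN: "f a \<subseteq> {0..<N}" if "a \<subseteq> {0..<n}" for a using f that by blast
  have ex: "\<exists>x. x \<in> f {i} \<and> x \<notin> f ({0..<n} - {i})" if "i < n" for i
    using le[of "{i}" "{0..<n} - {i}"] that by auto
  define x where "x i = (SOME x. x \<in> f {i} \<and> x \<notin> f ({0..<n} - {i}))" for i
  have x: "x i \<in> f {i} \<and> x i \<notin> f ({0..<n} - {i})" if "i < n" for i
    unfolding x_def using someI_ex[OF ex[OF that]] .
  have mem: "x i \<in> f A \<longleftrightarrow> i \<in> A" if "i < n" "A \<subseteq> {0..<n}" for i A
  proof
    assume "i \<in> A"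
    then show "x i \<in> f A" using x[OF that(1)] le[of "{i}" A] that by auto
  next
    assume *: "x i \<in> f A"
    show "i \<in> A"
    proof (rule ccontr)
      assume "i \<notin> A"
      then have "f A \<subseteq> f ({0..<n} - {i})" using le[of A "{0..<n} - {i}"] that by auto
      then show False using x[OF that(1)] * by auto
    qed
  qed
  have inj: "inj_on x {0..<n}"
  proof (rule inj_onI)
    fix i j assume ij: "i \<in> {0..<n}" "j \<in> {0..<n}" "x i = x j"
    have "x i \<in> f {i}" using mem[of i "{i}"] ij(1) by simp
    then have "j \<in> {i}" using mem[of j "{i}"] ij by simp
    then show "i = j" by simp
  qed
  define X where "X = x ` {0..<n}"
  define idx where "idx A = {i \<in> {0..<n}. x i \<in> A}" for A
  have idx: "idx A \<subseteq> {0..<n}" for A by (auto simp: idx_def)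
  show ?thesis
  proof (rule that[of X "\<lambda>A. f (idx A)" col])
    show "X \<subseteq> {0..<N}"
    proof -
      have "x i \<in> {0..<N}" if "i < n" for i using x[OF that] fN[of "{i}"] that by auto
      then show ?thesis unfolding X_def by auto
    qed
    show "card X = n" unfolding X_def using card_image[OF inj] by simp
    show "f (idx A) \<subseteq> {0..<N}" for A by (rule fN[OF idx])
    show "f (idx A) \<inter> X = A" if AX: "A \<subseteq> X" for A
    proof (intro set_eqI iffI)
      fix y assume "y \<in> f (idx A) \<inter> X"
      then obtain i where "i < n" "y = x i" "x i \<in> f (idx A)" unfolding X_def by auto
      then show "y \<in> A" using mem[OF _ idx[of A]] unfolding idx_def by blast
    next
      fix y assume y: "y \<in> A"
      then obtain i where "i < n" "y = x i" using AX unfolding X_def by auto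
      then show "y \<in> f (idx A) \<inter> X" using mem[OF _ idx[of A], of i] y AX unfolding idx_def by auto
    qed
    show "c (f (idx A)) = col" for A by (rule col[OF idx])
    show "f (idx A) \<subseteq> f (idx B)" if "A \<subseteq> B" for A B
      using that by (simp add: le[OF idx idx], auto simp: idx_def)
  qed
qed

text \<open>Converse of \<open>mono_Q_witness\<close>: the trace condition makes
  \<open>\<psi>\<close> order-reflecting, hence injective, so a monotone \<open>\<psi>\<close> is an
  induced embedding.\<close>

lemma mono_Q_intro:
  assumes X: "finite X" "card X = n"
    and N: "\<And>A. A \<subseteq> X \<Longrightarrow> \<psi> A \<subseteq> {0..<N}" and tr: "\<And>A. A \<subseteq> X \<Longrightarrow> \<psi> A \<inter> X = A"
    and c: "\<And>A. A \<subseteq> X \<Longrightarrow> c (\<psi> A) = col"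
    and mono: "\<And>A B. A \<subseteq> B \<Longrightarrow> B \<subseteq> X \<Longrightarrow> \<psi> A \<subseteq> \<psi> B"
  shows "has_mono_Q n c N"
proof -
  obtain x where x: "bij_betw x {0..<n} X"
    using ex_bij_betw_nat_finite[OF X(1)] X(2) by auto
  have im: "x ` A \<subseteq> X" if "A \<subseteq> {0..<n}" for A using x that unfolding bij_betw_def by blast
  have iff: "\<psi> (x ` a) \<subseteq> \<psi> (x ` b) \<longleftrightarrow> a \<subseteq> b" if "a \<subseteq> {0..<n}" "b \<subseteq> {0..<n}" for a b
  proof
    assume "a \<subseteq> b" then show "\<psi> (x ` a) \<subseteq> \<psi> (x ` b)" by (intro mono image_mono im[OF that(2)])
  next
    assume "\<psi> (x ` a) \<subseteq> \<psi> (x ` b)"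
    then have "x ` a \<subseteq> x ` b" using tr[OF im[OF that(1)]] tr[OF im[OF that(2)]] by blast
    then show "a \<subseteq> b" using inj_on_image_mem_iff[of x "{0..<n}" _ b] x that
      unfolding bij_betw_def by blast
  qed
  have "inj_on (\<lambda>a. \<psi> (x ` a)) (Pow {0..<n})"
  proof (rule inj_onI)
    fix a b assume ab: "a \<in> Pow {0..<n}" "b \<in> Pow {0..<n}" "\<psi> (x ` a) = \<psi> (x ` b)"
    have "a \<subseteq> b" "b \<subseteq> a" using iff[of a b] iff[of b a] ab by auto
    then show "a = b" by blast
  qed
  then show ?thesis unfolding has_mono_Q_def has_copy_def
    apply (intro exI[of _ col] exI[of _ "\<lambda>a. \<psi> (x ` a)"] conjI)
    subgoal by assumption
    subgoal using N[OF im] by blast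
    subgoal by (simp add: iff)
    subgoal by (simp add: c[OF im])
    done
qed

section \<open>Heights of chains\<close>

text \<open>There is a weakly increasing chain of \<open>i\<close> sets inside \<open>A\<close>
  whose \<open>j\<close>-th set satisfies \<open>P j\<close>. \<open>P\<close> stays abstract
  because both the alternating colors and the greedy lifting are instances.\<close>

fun reach :: "(nat \<Rightarrow> 'a set \<Rightarrow> bool) \<Rightarrow> nat \<Rightarrow> 'a set \<Rightarrow> bool" where
  "reach P 0 A = True"
| "reach P (Suc i) A = (\<exists>B\<subseteq>A. reach P i B \<and> P i B)"

lemma reach_mono: "reach P i A \<Longrightarrow> A \<subseteq> B \<Longrightarrow> reach P i B"
  by (cases i) (simp_all, blast intro: subset_trans)

lemma reach_chain:
  assumes "reach P m A"
  shows "\<exists>g. (\<forall>i<m. P i (g i) \<and> g i \<subseteq> A) \<and> (\<forall>i j. i \<le> j \<longrightarrow> j < m \<longrightarrow> g i \<subseteq> g j)"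
  using assms
proof (induction m arbitrary: A)
  case (Suc m)
  then obtain B where B: "B \<subseteq> A" "reach P m B" "P m B" by auto
  from Suc.IH[OF B(2)] obtain g where g: "\<forall>i<m. P i (g i) \<and> g i \<subseteq> B"
    "\<forall>i j. i \<le> j \<longrightarrow> j < m \<longrightarrow> g i \<subseteq> g j" by blast
  define g' where "g' = g(m := B)"
  have "P i (g' i) \<and> g' i \<subseteq> A" if "i < Suc m" for i
  proof (cases "i = m")
    case False
    then have "i < m" using that by simp
    then show ?thesis using g(1) B(1) False unfolding g'_def by auto
  qed (use B in \<open>simp add: g'_def\<close>)
  moreover have "g' i \<subseteq> g' j" if "i \<le> j" "j < Suc m" for i j
    using that g unfolding g'_def by (cases "i = m"; cases "j = m") auto
  ultimately show ?case by blast
qed simp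

text \<open>The greatest length of such a chain below \<open>A\<close>, provided that these lengths
  are bounded.\<close>

definition height :: "(nat \<Rightarrow> 'a set \<Rightarrow> bool) \<Rightarrow> 'a set \<Rightarrow> nat" where
  "height P A = (LEAST i. \<not> reach P (Suc i) A)"

text \<open>A longest chain below \<open>A\<close> cannot be continued by \<open>A\<close> itself,
  so \<open>P\<close> fails at the height. The assumption bounds the lengths, so that the
  \<open>LEAST\<close> is attained.\<close>

lemma height:
  assumes "\<not> reach P (Suc K) A"
  shows height_le: "height P A \<le> K" and height_not: "\<not> P (height P A) A"
    and height_not_reach: "\<not> reach P (Suc (height P A)) A"
proof -
  show "height P A \<le> K" unfolding height_def using assms by (rule Least_le)
  show n: "\<not> reach P (Suc (height P A)) A" unfolding height_def using assms by (rule LeastI)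
  have "reach P (height P A) A"
  proof (cases "height P A")
    case (Suc i)
    then have "i < height P A" by simp
    then have "reach P (Suc i) A" unfolding height_def using not_less_Least by blast
    then show ?thesis using Suc by simp
  qed simp
  then show "\<not> P (height P A) A" using n by auto
qed

lemma height_mono:
  assumes "A \<subseteq> B" "\<not> reach P (Suc K) B"
  shows "height P A \<le> height P B"
proof -
  have "\<not> reach P (Suc (height P B)) A"
    using height_not_reach[OF assms(2)] reach_mono assms(1) by blast
  then show ?thesis using height_le by blast
qed

section \<open>Upper bound\<close>

text \<open>Consecutive sets have different colors, so the weak inclusions of the chain are
  strict.\<close>

lemma reach_rbr_chain:
  assumes r: "reach (\<lambda>i S. c S = even i) t S" and S: "S \<subseteq> {0..<N}"
  shows "has_rbr_chain t c N"
proof -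
  obtain g where g: "\<And>i. i < t \<Longrightarrow> c (g i) = even i" "\<And>i. i < t \<Longrightarrow> g i \<subseteq> S"
    and m: "\<And>i j. i \<le> j \<Longrightarrow> j < t \<Longrightarrow> g i \<subseteq> g j"
    using reach_chain[OF r] by blast
  have ns: "\<not> g j \<subseteq> g i" if "i < j" "j < t" for i j
  proof
    assume *: "g j \<subseteq> g i"
    have "g i \<subseteq> g (Suc i)" "g (Suc i) \<subseteq> g j" using m that by auto
    then have "g i = g (Suc i)" using * by blast
    then show False using g(1)[of i] g(1)[of "Suc i"] that by auto
  qed
  have iff: "g i \<subseteq> g j \<longleftrightarrow> i \<le> j" if "i < t" "j < t" for i j
    using ns[of j i] m[of i j] that by (cases "i \<le> j") auto
  have "inj_on g {0..<t}"
  proof (rule inj_onI)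
    fix i j assume "i \<in> {0..<t}" "j \<in> {0..<t}" "g i = g j"
    then show "i = j" using iff[of i j] iff[of j i] by simp
  qed
  moreover have "g ` {0..<t} \<subseteq> Pow {0..<N}" using order_trans[OF g(2) S] by (simp add: image_subset_iff)
  ultimately show ?thesis unfolding has_rbr_chain_def has_copy_def
    using g(1) iff by (intro exI[of _ g]) simp
qed

lemma bounded_mono_stationary:
  fixes u :: "nat \<Rightarrow> nat"
  assumes "\<And>i. i < s \<Longrightarrow> u i \<le> u (Suc i)" "u s < s"
  shows "\<exists>i<s. u i = u (Suc i)"
proof (rule ccontr)
  assume "\<not> ?thesis"
  then have lt: "u i < u (Suc i)" if "i < s" for i using assms(1)[OF that] that by (meson le_neq_implies_less)
  have "i \<le> s \<Longrightarrow> i \<le> u i" for i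
  proof (induction i)
    case (Suc i) then show ?case using lt[of i] by linarith
  qed simp
  then show False using assms(2) by fastforce
qed

text \<open>If all chains for \<open>P\<close> had length at most \<open>K\<close>, adding to
  \<open>A\<close> the first \<open>height P A\<close> outside points would give a blue set,
  monotonically in \<open>A\<close>, and so a blue copy.\<close>

lemma red_Y_chain:
  assumes no: "\<not> has_mono_Q n c (n + K)"
  shows "\<exists>g. (\<forall>i\<le>K. c (g i \<union> {n..<n+i}) \<and> g i \<subseteq> {0..<n}) \<and> (\<forall>i j. i \<le> j \<longrightarrow> j \<le> K \<longrightarrow> g i \<subseteq> g j)"
proof -
  define P where "P i A = c (A \<union> {n..<n+i})" for i A
  have "reach P (Suc K) {0..<n}"
  proof (rule ccontr)
    assume nr: "\<not> reach P (Suc K) {0..<n}"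
    then have nA: "\<not> reach P (Suc K) A" if "A \<subseteq> {0..<n}" for A using reach_mono that by blast
    have "has_mono_Q n c (n + K)"
    proof (rule mono_Q_intro[where X = "{0..<n}" and \<psi> = "\<lambda>A. A \<union> {n..<n + height P A}" and col = False])
      fix A assume A: "A \<subseteq> {0..<n}"
      show "A \<union> {n..<n + height P A} \<subseteq> {0..<n + K}" using A height_le[OF nA[OF A]] by auto
      show "(A \<union> {n..<n + height P A}) \<inter> {0..<n} = A" using A by auto
      show "c (A \<union> {n..<n + height P A}) = False" using height_not[OF nA[OF A]] unfolding P_def by simp
    next
      fix A B :: "nat set" assume AB: "A \<subseteq> B" "B \<subseteq> {0..<n}"
      show "A \<union> {n..<n + height P A} \<subseteq> B \<union> {n..<n + height P B}"
        using AB height_mono[OF AB(1) nA[OF AB(2)]] by auto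
    qed simp_all
    then show False using no by blast
  qed
  from reach_chain[OF this] obtain g where
    "(\<forall>i<Suc K. P i (g i) \<and> g i \<subseteq> {0..<n}) \<and> (\<forall>i j. i \<le> j \<longrightarrow> j < Suc K \<longrightarrow> g i \<subseteq> g j)" by blast
  then show ?thesis unfolding P_def less_Suc_eq_le by blast
qed

lemma chain_or_mono_Q:
  assumes "t \<ge> 1"
  shows "has_rbr_chain t c ((t div 2 + 1) * n) \<or> has_mono_Q n c ((t div 2 + 1) * n)"
proof (rule ccontr)
  define s where "s = t div 2"
  define N where "N = n + s * n"
  have N: "(t div 2 + 1) * n = N" by (simp add: N_def s_def)
  assume "\<not> ?thesis"
  then have nc: "\<not> has_rbr_chain t c N" and nq: "\<not> has_mono_Q n c N" by (auto simp only: N)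
  define P where "P i S \<longleftrightarrow> c S = even i" for i :: nat and S :: "nat set"
  define h where "h = height P"
  have nr: "\<not> reach P (Suc (t - 1)) S" if "S \<subseteq> {0..<N}" for S
    using reach_rbr_chain[of c t S N] nc that assms unfolding P_def by auto
  \<comment> \<open>Failure of \<open>P\<close> at the height says that exactly the sets of odd
    height are red.\<close>
  have hle: "h S \<le> t - 1" and hc: "c S \<longleftrightarrow> odd (h S)" if "S \<subseteq> {0..<N}" for S
    using height_le[OF nr[OF that]] height_not[OF nr[OF that]] unfolding h_def P_def by auto
  have hm: "h S \<le> h S'" if "S \<subseteq> S'" "S' \<subseteq> {0..<N}" for S S'
    using height_mono[OF that(1) nr[OF that(2)]] unfolding h_def .
  obtain g where g: "\<And>i. i \<le> s * n \<Longrightarrow> c (g i \<union> {n..<n+i})" "\<And>i. i \<le> s * n \<Longrightarrow> g i \<subseteq> {0..<n}"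
    "\<And>i j. i \<le> j \<Longrightarrow> j \<le> s * n \<Longrightarrow> g i \<subseteq> g j"
    using red_Y_chain[OF nq[unfolded N_def]] by blast
  \<comment> \<open>Every \<open>n\<close>-th member of the red chain: \<open>s + 1\<close> sets,
    each with \<open>n\<close> more points outside \<open>{0..<n}\<close> than the one
    before.\<close>
  define S where "S i = g (i * n) \<union> {n..<n + i * n}" for i
  have SN: "S i \<subseteq> {0..<N}" and Sred: "c (S i)" if "i \<le> s" for i
  proof -
    have "i * n \<le> s * n" using that by simp
    then show "S i \<subseteq> {0..<N}" "c (S i)" using g(1,2)[of "i * n"] unfolding S_def N_def by auto
  qed
  have Sm: "S i \<subseteq> S (Suc i)" if "i < s" for i
  proof -
    have "Suc i * n \<le> s * n" by (rule mult_le_mono1) (use that in simp)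
    then have "g (i * n) \<subseteq> g (Suc i * n)" by (intro g(3)) simp_all
    then show ?thesis unfolding S_def by (intro Un_mono) auto
  qed
  have odd: "odd (h (S i))" if "i \<le> s" for i using hc[OF SN[OF that]] Sred[OF that] by simp
  \<comment> \<open>The heights are odd and at most \<open>t - 1\<close>, so their halves lie below
    \<open>t div 2 = s\<close>, too few values for \<open>s + 1\<close> sets.\<close>
  have "\<exists>i<s. h (S i) div 2 = h (S (Suc i)) div 2"
  proof (rule bounded_mono_stationary[of s "\<lambda>i. h (S i) div 2"])
    show "h (S i) div 2 \<le> h (S (Suc i)) div 2" if "i < s" for i
      using hm[OF Sm[OF that] SN] that by (simp add: div_le_mono)
    show "h (S s) div 2 < s" using odd[of s] hle[OF SN[of s]] assms unfolding s_def
      by (auto elim!: oddE)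
  qed
  then obtain i where i: "i < s" "h (S i) div 2 = h (S (Suc i)) div 2" by blast
  have eq: "h (S i) = h (S (Suc i))"
    using i odd[of i] odd[of "Suc i"] by (metis Suc_leI less_imp_le odd_two_times_div_two_succ)
  define X where "X = {n + i * n..<n + Suc i * n}"
  have sub: "S i \<union> A \<subseteq> S (Suc i)" if "A \<subseteq> X" for A
  proof -
    have "X \<subseteq> S (Suc i)" unfolding X_def S_def by auto
    then show ?thesis using that Sm[OF i(1)] by blast
  qed
  have "has_mono_Q n c N"
  proof (rule mono_Q_intro[where X = X and \<psi> = "\<lambda>A. S i \<union> A" and col = True])
    fix A assume A: "A \<subseteq> X"
    show AN: "S i \<union> A \<subseteq> {0..<N}" using sub[OF A] SN[of "Suc i"] i by auto
    have "g (i * n) \<subseteq> {0..<n}" using g(2)[of "i * n"] i by simp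
    then have "S i \<subseteq> {0..<n + i * n}" unfolding S_def by auto
    then have "S i \<inter> X = {}" unfolding X_def by auto
    then show "(S i \<union> A) \<inter> X = A" using A by blast
    \<comment> \<open>The height is squeezed between two equal odd values, which keeps the set
      red.\<close>
    have "h (S i) \<le> h (S i \<union> A)" "h (S i \<union> A) \<le> h (S (Suc i))"
      using hm[OF _ AN] hm[OF sub[OF A] SN] i by auto
    then have "h (S i \<union> A) = h (S i)" using eq by simp
    then show "c (S i \<union> A) = True" using hc[OF AN] odd[of i] i by simp
  qed (auto simp: X_def)
  then show False using nq by blast
qed

lemma EH_chain_le:
  assumes "t \<ge> 1"
  shows "EH_chain t n \<le> (t div 2 + 1) * n"
  unfolding EH_chain_def using chain_or_mono_Q[OF assms] by (intro Least_le) blast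

section \<open>Lower bounds from colorings without copies\<close>

text \<open>The upper bound guarantees that the \<open>LEAST\<close> is attained. Copies persist in
  larger lattices, so a coloring without copies in dimension \<open>N\<close> excludes every value
  up to \<open>N\<close>.\<close>

lemma EH_chain_greater:
  assumes "t \<ge> 1" "\<not> has_rbr_chain t c N" "\<not> has_mono_Q n c N"
  shows "N < EH_chain t n"
proof (rule ccontr)
  assume "\<not> N < EH_chain t n"
  moreover have "\<forall>c. has_rbr_chain t c (EH_chain t n) \<or> has_mono_Q n c (EH_chain t n)"
    unfolding EH_chain_def
    by (rule LeastI[where P = "\<lambda>N. \<forall>c. has_rbr_chain t c N \<or> has_mono_Q n c N"])
      (use chain_or_mono_Q[OF assms(1)] in blast)
  ultimately show False
    using assms(2,3) has_rbr_chain_mono[of t c "EH_chain t n" N] has_mono_Q_mono[of n c "EH_chain t n" N]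
    by auto
qed

text \<open>Color by the size threshold \<open>n\<close> in dimension \<open>2 * n - 1\<close>: no
  blue set contains a red one. The top of a monochromatic copy contains \<open>X\<close> and is red,
  hence so is the bottom, whose \<open>n\<close> or more points are disjoint from
  \<open>X\<close>.\<close>

lemma EH_chain_ge_double:
  assumes "t \<ge> 2" "n \<ge> 1"
  shows "2 * n \<le> EH_chain t n"
proof -
  define c :: "nat set \<Rightarrow> bool" where "c S \<longleftrightarrow> n \<le> card S" for S
  have "\<not> has_rbr_chain t c (2 * n - 1)"
  proof
    assume "has_rbr_chain t c (2 * n - 1)"
    then obtain f where f: "\<And>i. i < t \<Longrightarrow> f i \<subseteq> {0..<2 * n - 1}"
      "\<And>i j. i \<le> j \<Longrightarrow> j < t \<Longrightarrow> f i \<subseteq> f j" "\<And>i. i < t \<Longrightarrow> c (f i) = even i"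
      by (rule rbr_chainE) blast
    have "card (f 0) \<le> card (f 1)"
      using f(1)[of 1] f(2)[of 0 1] assms by (intro card_mono) (auto intro: finite_subset)
    then show False using f(3)[of 0] f(3)[of 1] assms unfolding c_def by simp
  qed
  moreover have "\<not> has_mono_Q n c (2 * n - 1)"
  proof
    assume "has_mono_Q n c (2 * n - 1)"
    then obtain X \<psi> col where X: "X \<subseteq> {0..<2 * n - 1}" "card X = n"
      and N: "\<And>A. A \<subseteq> X \<Longrightarrow> \<psi> A \<subseteq> {0..<2 * n - 1}" and tr: "\<And>A. A \<subseteq> X \<Longrightarrow> \<psi> A \<inter> X = A"
      and col: "\<And>A. A \<subseteq> X \<Longrightarrow> c (\<psi> A) = col"
      by (rule mono_Q_witness) blast
    have fin: "finite (\<psi> A)" if "A \<subseteq> X" for A using N[OF that] finite_subset by blast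
    have "X \<subseteq> \<psi> X" using tr[of X] by blast
    then have "c (\<psi> X)" using X(2) card_mono[OF fin[of X]] unfolding c_def by auto
    then have "n \<le> card (\<psi> {})" using col[of X] col[of "{}"] unfolding c_def by auto
    moreover have "card (\<psi> {}) + card X = card (\<psi> {} \<union> X)"
      by (rule card_Un_disjoint[symmetric]) (use tr[of "{}"] fin[of "{}"] X(1) in \<open>auto intro: finite_subset\<close>)
    moreover have "card (\<psi> {} \<union> X) \<le> card {0..<2 * n - 1}"
      by (rule card_mono) (use N[of "{}"] X(1) in auto)
    ultimately show False using X(2) assms by simp
  qed
  ultimately show ?thesis using EH_chain_greater[of t c "2 * n - 1" n] assms by simp
qed

section \<open>Four layers around a family of sets\<close>

definition layered :: "nat \<Rightarrow> nat \<Rightarrow> nat set set \<Rightarrow> nat set \<Rightarrow> bool" where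
  "layered k u \<H> S \<longleftrightarrow> (k \<le> card S \<and> (\<exists>H\<in>\<H>. S \<subseteq> H)) \<or> u < card S"

text \<open>Going up a chain, the size conditions switch on and lying below a member of
  \<open>\<H>\<close> switches off, so the colors run at most through blue, red, blue, red. Four
  alternating sets starting with red do not fit.\<close>

lemma layered_no_chain:
  assumes "t \<ge> 4"
  shows "\<not> has_rbr_chain t (layered k u \<H>) N"
proof
  assume "has_rbr_chain t (layered k u \<H>) N"
  then obtain f where f: "\<And>i. i < t \<Longrightarrow> f i \<subseteq> {0..<N}"
    "\<And>i j. i \<le> j \<Longrightarrow> j < t \<Longrightarrow> f i \<subseteq> f j" "\<And>i. i < t \<Longrightarrow> layered k u \<H> (f i) = even i"
    by (rule rbr_chainE) blast
  have sub: "f 0 \<subseteq> f 1" "f 1 \<subseteq> f 2" "f 2 \<subseteq> f 3" using f(2) assms by auto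
  have card: "card (f 0) \<le> card (f 1)" "card (f 2) \<le> card (f 3)"
    using f(1)[of 1] f(1)[of 3] sub assms by (auto intro!: card_mono intro: finite_subset)
  have 1: "\<not> layered k u \<H> (f 1)" and 3: "\<not> layered k u \<H> (f 3)"
    and 0: "layered k u \<H> (f 0)" and 2: "layered k u \<H> (f 2)" using f(3) assms by auto
  have "k \<le> card (f 1)" using 0 1 card unfolding layered_def by linarith
  then have "\<not> (\<exists>H\<in>\<H>. f 2 \<subseteq> H)" using 1 sub unfolding layered_def by blast
  then show False using 2 3 card unfolding layered_def by linarith
qed

text \<open>\<open>cover\<close> excludes a blue copy, \<open>avoid\<close> a red one. The threshold
  \<open>N - k\<close> serves both: a blue set containing \<open>X\<close> has at most
  \<open>N - n - k\<close> points outside \<open>X\<close>, and a set with only \<open>n - k\<close>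
  points in \<open>X\<close> stays out of the top layer.\<close>

lemma layered_no_mono_Q:
  assumes k: "k \<le> n" "n + k \<le> N"
    and cover: "\<And>X W. X \<subseteq> {0..<N} \<Longrightarrow> card X = n \<Longrightarrow> W \<subseteq> {0..<N} - X \<Longrightarrow> card W = N - n - k
      \<Longrightarrow> \<exists>F\<subseteq>X. card F = k \<and> F \<union> W \<in> \<H>"
    and avoid: "\<And>X F. X \<subseteq> {0..<N} \<Longrightarrow> card X = n \<Longrightarrow> F \<subseteq> {0..<N} - X \<Longrightarrow> card F = k
      \<Longrightarrow> \<exists>B\<subseteq>X. card B = n - k \<and> (\<forall>H\<in>\<H>. \<not> F \<union> B \<subseteq> H)"
  shows "\<not> has_mono_Q n (layered k (N - k) \<H>) N"
proof
  assume "has_mono_Q n (layered k (N - k) \<H>) N"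
  then obtain X \<psi> col where X: "X \<subseteq> {0..<N}" "card X = n"
    and sN: "\<And>A. A \<subseteq> X \<Longrightarrow> \<psi> A \<subseteq> {0..<N}" and tr: "\<And>A. A \<subseteq> X \<Longrightarrow> \<psi> A \<inter> X = A"
    and col: "\<And>A. A \<subseteq> X \<Longrightarrow> layered k (N - k) \<H> (\<psi> A) = col"
    and mono: "\<And>A B. A \<subseteq> B \<Longrightarrow> B \<subseteq> X \<Longrightarrow> \<psi> A \<subseteq> \<psi> B"
    by (rule mono_Q_witness) blast
  have fin: "finite (\<psi> A)" if "A \<subseteq> X" for A using sN[OF that] finite_subset by blast
  have finX: "finite X" using X(1) finite_subset by blast
  have cardC: "card ({0..<N} - X) = N - n" using X finX by (simp add: card_Diff_subset)
  show False
  proof (cases col)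
    case False
    have "X \<subseteq> \<psi> X" using tr[of X] by blast
    then have "card (\<psi> X - X) = card (\<psi> X) - n" using X finX by (simp add: card_Diff_subset)
    moreover have "card (\<psi> X) \<le> N - k" using col[of X] False unfolding layered_def by simp
    ultimately have "card (\<psi> X - X) \<le> N - n - k" by simp
    \<comment> \<open>The outside points of the whole copy are padded to the exact size that
      \<open>cover\<close> asks for.\<close>
    then obtain W where W: "\<psi> X - X \<subseteq> W" "W \<subseteq> {0..<N} - X" "card W = N - n - k"
      using exists_subset_between[of "\<psi> X - X" "N - n - k" "{0..<N} - X", OF _ _ Diff_mono[OF sN[of X] order_refl]]
        diff_le_self[of "N - n" k] cardC by auto
    obtain F where F: "F \<subseteq> X" "card F = k" "F \<union> W \<in> \<H>" using cover[OF X W(2,3)] by blast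
    have "F \<subseteq> \<psi> F" using tr[OF F(1)] by blast
    then have "k \<le> card (\<psi> F)" using F(2) card_mono[OF fin[OF F(1)]] by blast
    moreover have "\<psi> F \<subseteq> F \<union> W" using mono[OF F(1) order_refl] tr[OF F(1)] W(1) by blast
    ultimately have "layered k (N - k) \<H> (\<psi> F)" using F(3) unfolding layered_def by blast
    then show False using col[OF F(1)] False by simp
  next
    case True
    have dis: "\<psi> {} \<subseteq> {0..<N} - X" using sN[of "{}"] tr[of "{}"] by blast
    then have "card (\<psi> {}) \<le> N - n" using card_mono[OF _ dis] cardC by simp
    \<comment> \<open>With at most \<open>N - n \<le> N - k\<close> points the bottom is not in the
      top layer, so being red it has at least \<open>k\<close> points.\<close>
    then have "k \<le> card (\<psi> {})" using col[of "{}"] True k unfolding layered_def by auto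
    then obtain F where F: "F \<subseteq> \<psi> {}" "card F = k" using obtain_subset_with_card_n by metis
    obtain B where B: "B \<subseteq> X" "card B = n - k" "\<forall>H\<in>\<H>. \<not> F \<union> B \<subseteq> H"
      using avoid[OF X _ F(2)] F(1) dis by blast
    have "\<psi> B \<subseteq> B \<union> ({0..<N} - X)" using tr[OF B(1)] sN[OF B(1)] by blast
    then have "card (\<psi> B) \<le> card (B \<union> ({0..<N} - X))"
      by (rule card_mono[rotated]) (use finite_subset[OF B(1) finX] in simp)
    also have "\<dots> \<le> (n - k) + (N - n)" using card_Un_le[of B "{0..<N} - X"] B(2) cardC by simp
    finally have "card (\<psi> B) \<le> N - k" using k by simp
    then obtain H where H: "H \<in> \<H>" "\<psi> B \<subseteq> H" using col[OF B(1)] True unfolding layered_def by auto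
    have "F \<union> B \<subseteq> \<psi> B" using F(1) mono[of "{}" B] tr[OF B(1)] B(1) by blast
    then show False using B(3) H by blast
  qed
qed

section \<open>A random family\<close>

text \<open>Disjoint sets are hit at different indices, so every such function belongs to one of at
  most \<open>T ^ q\<close> injective choices of indices. A fixed choice allows at most
  \<open>b ^ q * card L ^ (T - q)\<close> functions; multiplying by \<open>card L ^ q\<close> avoids
  division.\<close>

lemma card_functions_hitting:
  fixes q T :: nat
  assumes L: "finite L" and \<beta>: "\<And>s. s < q \<Longrightarrow> \<beta> s \<subseteq> L" "\<And>s. s < q \<Longrightarrow> card (\<beta> s) \<le> b"
    and dis: "disjoint_family_on \<beta> {..<q}"
  shows "card {\<omega> \<in> {..<T} \<rightarrow>\<^sub>E L. \<forall>s<q. \<exists>m<T. \<omega> m \<in> \<beta> s} * card L ^ q \<le> (T * b) ^ q * card L ^ T"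
proof -
  define I where "I = {\<iota> \<in> {..<q} \<rightarrow>\<^sub>E {..<T}. inj_on \<iota> {..<q}}"
  \<comment> \<open>For injective \<open>\<iota>\<close>, the functions that hit
    \<open>\<beta> s\<close> at the index \<open>\<iota> s\<close> for every
    \<open>s < q\<close>.\<close>
  define R where "R \<iota> = Pi\<^sub>E {..<T} (\<lambda>m. if m \<in> \<iota> ` {..<q} then \<beta> (inv_into {..<q} \<iota> m) else L)" for \<iota>
  let ?E = "{\<omega> \<in> {..<T} \<rightarrow>\<^sub>E L. \<forall>s<q. \<exists>m<T. \<omega> m \<in> \<beta> s}"
  have finI: "finite I" unfolding I_def by (simp add: finite_PiE)
  have cardI: "card I \<le> T ^ q"
  proof -
    have "card I \<le> card ({..<q} \<rightarrow>\<^sub>E {..<T})" unfolding I_def by (rule card_mono) (auto simp: finite_PiE)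
    then show ?thesis by (simp add: card_funcsetE)
  qed
  have finR: "finite (R \<iota>)" for \<iota> unfolding R_def
  proof (rule finite_PiE)
    fix m show "finite (if m \<in> \<iota> ` {..<q} then \<beta> (inv_into {..<q} \<iota> m) else L)"
      using inv_into_into[of m \<iota> "{..<q}"] finite_subset[OF \<beta>(1) L] L by auto
  qed simp
  have cardR: "card (R \<iota>) * card L ^ q \<le> b ^ q * card L ^ T" if "\<iota> \<in> I" for \<iota>
  proof -
    have inj: "inj_on \<iota> {..<q}" and im: "\<iota> ` {..<q} \<subseteq> {..<T}" using that unfolding I_def by auto
    let ?g = "\<lambda>m. card (if m \<in> \<iota> ` {..<q} then \<beta> (inv_into {..<q} \<iota> m) else L)"
    have "card (R \<iota>) = (\<Prod>m<T. ?g m)" unfolding R_def by (simp add: card_PiE)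
    also have "\<dots> = (\<Prod>m\<in>{..<T} - \<iota> ` {..<q}. ?g m) * (\<Prod>m\<in>\<iota> ` {..<q}. ?g m)"
      by (rule prod.subset_diff[OF im]) simp
    also have "(\<Prod>m\<in>{..<T} - \<iota> ` {..<q}. ?g m) = card L ^ (T - q)"
      using card_image[OF inj] im by (simp add: card_Diff_subset)
    also have "(\<Prod>m\<in>\<iota> ` {..<q}. ?g m) = (\<Prod>s<q. card (\<beta> s))"
      unfolding prod.reindex[OF inj] using inj by (intro prod.cong) auto
    also have "\<dots> \<le> b ^ q" using prod_mono[of "{..<q}" "\<lambda>s. card (\<beta> s)" "\<lambda>_. b"] \<beta>(2) by simp
    finally have "card (R \<iota>) \<le> card L ^ (T - q) * b ^ q" by simp
    then have "card (R \<iota>) * card L ^ q \<le> card L ^ (T - q) * b ^ q * card L ^ q" by (rule mult_le_mono1)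
    moreover have "q \<le> T" using card_mono[OF _ im] card_image[OF inj] by simp
    ultimately show ?thesis by (simp add: power_add[symmetric] mult.commute mult.left_commute)
  qed
  have "?E \<subseteq> (\<Union>\<iota>\<in>I. R \<iota>)"
  proof
    fix \<omega> assume "\<omega> \<in> ?E"
    then have \<omega>: "\<omega> \<in> {..<T} \<rightarrow>\<^sub>E L" and hit: "\<forall>s<q. \<exists>m<T. \<omega> m \<in> \<beta> s" by auto
    define \<iota> where "\<iota> = (\<lambda>s\<in>{..<q}. SOME m. m < T \<and> \<omega> m \<in> \<beta> s)"
    have \<iota>: "\<iota> s < T" "\<omega> (\<iota> s) \<in> \<beta> s" if "s < q" for s
      using someI_ex[OF hit[rule_format, OF that]] that unfolding \<iota>_def by auto
    have inj: "inj_on \<iota> {..<q}"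
    proof (rule inj_onI)
      fix s s' assume s: "s \<in> {..<q}" "s' \<in> {..<q}" "\<iota> s = \<iota> s'"
      then have "\<omega> (\<iota> s) \<in> \<beta> s \<inter> \<beta> s'" using \<iota>(2)[of s] \<iota>(2)[of s'] by simp
      then show "s = s'" using dis s(1,2) unfolding disjoint_family_on_def by blast
    qed
    have "\<iota> \<in> I" unfolding I_def using \<iota>(1) inj by (auto simp: \<iota>_def)
    moreover have "\<omega> \<in> R \<iota>" unfolding R_def
    proof (rule PiE_I)
      fix m assume m: "m \<in> {..<T}"
      show "\<omega> m \<in> (if m \<in> \<iota> ` {..<q} then \<beta> (inv_into {..<q} \<iota> m) else L)"
      proof (cases "m \<in> \<iota> ` {..<q}")
        case True
        then obtain s where "s < q" "m = \<iota> s" by auto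
        then show ?thesis using inj \<iota>(2) by simp
      qed (use \<omega> m in auto)
    qed (use \<omega> in auto)
    ultimately show "\<omega> \<in> (\<Union>\<iota>\<in>I. R \<iota>)" by blast
  qed
  then have "card ?E \<le> card (\<Union>\<iota>\<in>I. R \<iota>)" by (rule card_mono[rotated]) (use finI finR in simp)
  also have "\<dots> \<le> (\<Sum>\<iota>\<in>I. card (R \<iota>))" by (rule card_UN_le[OF finI])
  finally have "card ?E * card L ^ q \<le> (\<Sum>\<iota>\<in>I. card (R \<iota>) * card L ^ q)"
    by (simp add: sum_distrib_right[symmetric])
  also have "\<dots> \<le> (\<Sum>\<iota>\<in>I. b ^ q * card L ^ T)" by (rule sum_mono) (rule cardR)
  also have "\<dots> \<le> T ^ q * (b ^ q * card L ^ T)" using cardI by simp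
  finally show ?thesis by (simp add: power_mult_distrib mult.assoc)
qed

text \<open>A union bound by counting, for \<open>T\<close> independent uniform samples from
  \<open>L\<close>. The summands of \<open>bound\<close> estimate the probability that some
  \<open>\<alpha> i\<close> receives no sample and that, for some \<open>j\<close>, all the disjoint
  sets \<open>\<beta> j s\<close> are hit.\<close>

lemma random_family:
  fixes L :: "'a set" and \<alpha> :: "'i \<Rightarrow> 'a set" and \<beta> :: "'j \<Rightarrow> nat \<Rightarrow> 'a set"
  assumes L: "finite L" "L \<noteq> {}" and I: "finite I" and J: "finite J"
    and \<alpha>: "\<And>i. i \<in> I \<Longrightarrow> \<alpha> i \<subseteq> L" "\<And>i. i \<in> I \<Longrightarrow> a \<le> card (\<alpha> i)"
    and \<beta>: "\<And>j s. j \<in> J \<Longrightarrow> s < q \<Longrightarrow> \<beta> j s \<subseteq> L" "\<And>j s. j \<in> J \<Longrightarrow> s < q \<Longrightarrow> card (\<beta> j s) \<le> b"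
    and dis: "\<And>j. j \<in> J \<Longrightarrow> disjoint_family_on (\<beta> j) {..<q}"
    and aL: "a \<le> card L"
    and bound: "real (card I) * (1 - real a / card L) ^ T + real (card J) * (T * real b / card L) ^ q < 1"
  shows "\<exists>\<H>\<subseteq>L. (\<forall>i\<in>I. \<H> \<inter> \<alpha> i \<noteq> {}) \<and> (\<forall>j\<in>J. \<exists>s<q. \<H> \<inter> \<beta> j s = {})"
proof -
  define D where "D = card L"
  have D: "D > 0" using L unfolding D_def by (simp add: card_gt_0_iff)
  let ?\<Omega> = "{..<T} \<rightarrow>\<^sub>E L"
  define A where "A i = ({..<T} \<rightarrow>\<^sub>E (L - \<alpha> i))" for i
  define B where "B j = {\<omega> \<in> ?\<Omega>. \<forall>s<q. \<exists>m<T. \<omega> m \<in> \<beta> j s}" for j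
  have fin\<Omega>: "finite ?\<Omega>" using L by (simp add: finite_PiE)
  have card\<Omega>: "card ?\<Omega> = D ^ T" by (simp add: card_funcsetE D_def)
  have finA: "finite (A i)" for i unfolding A_def using L by (simp add: finite_PiE)
  have finB: "finite (B j)" for j unfolding B_def using fin\<Omega> by simp
  have A: "real (card (A i)) \<le> (1 - real a / D) ^ T * D ^ T" if "i \<in> I" for i
  proof -
    have "card (L - \<alpha> i) \<le> D - a"
      using card_Diff_subset[OF finite_subset[OF \<alpha>(1)[OF that] L(1)] \<alpha>(1)[OF that]] \<alpha>(2)[OF that]
      unfolding D_def by simp
    then have "card (A i) \<le> (D - a) ^ T" unfolding A_def by (simp add: card_funcsetE power_mono)
    then have "real (card (A i)) \<le> real (D - a) ^ T" by (metis of_nat_le_iff of_nat_power)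
    also have "real (D - a) = (1 - real a / D) * D" using D aL unfolding D_def
      by (simp add: field_simps)
    finally show ?thesis by (simp add: power_mult_distrib)
  qed
  have B: "real (card (B j)) \<le> (T * real b / D) ^ q * D ^ T" if "j \<in> J" for j
  proof -
    have "card (B j) * D ^ q \<le> (T * b) ^ q * D ^ T"
      using card_functions_hitting[OF L(1) \<beta>[OF that] dis[OF that]] unfolding B_def D_def by blast
    then have "real (card (B j) * D ^ q) \<le> real ((T * b) ^ q * D ^ T)" by (rule of_nat_mono)
    then show ?thesis using D by (simp add: power_divide field_simps)
  qed
  have "card ((\<Union>i\<in>I. A i) \<union> (\<Union>j\<in>J. B j)) \<le> (\<Sum>i\<in>I. card (A i)) + (\<Sum>j\<in>J. card (B j))"
    using card_Un_le[of "\<Union>i\<in>I. A i" "\<Union>j\<in>J. B j"] card_UN_le[OF I, of A] card_UN_le[OF J, of B]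
    by linarith
  then have "real (card ((\<Union>i\<in>I. A i) \<union> (\<Union>j\<in>J. B j)))
      \<le> (\<Sum>i\<in>I. real (card (A i))) + (\<Sum>j\<in>J. real (card (B j)))"
    by (metis of_nat_add of_nat_le_iff of_nat_sum)
  also have "\<dots> \<le> (\<Sum>i\<in>I. (1 - real a / D) ^ T * D ^ T) + (\<Sum>j\<in>J. (T * real b / D) ^ q * D ^ T)"
    by (intro add_mono sum_mono A B)
  also have "\<dots> = (card I * (1 - real a / D) ^ T + card J * (T * real b / D) ^ q) * D ^ T"
    by (simp add: algebra_simps)
  also have "\<dots> < 1 * real (D ^ T)" using bound D unfolding D_def by (intro mult_strict_right_mono) auto
  finally have "card ((\<Union>i\<in>I. A i) \<union> (\<Union>j\<in>J. B j)) < card ?\<Omega>" using card\<Omega> by simp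
  then have "\<not> ?\<Omega> \<subseteq> (\<Union>i\<in>I. A i) \<union> (\<Union>j\<in>J. B j)"
    using card_mono[of "(\<Union>i\<in>I. A i) \<union> (\<Union>j\<in>J. B j)" ?\<Omega>] I J finA finB by auto
  then obtain \<omega> where \<omega>: "\<omega> \<in> ?\<Omega>" "\<And>i. i \<in> I \<Longrightarrow> \<omega> \<notin> A i" "\<And>j. j \<in> J \<Longrightarrow> \<omega> \<notin> B j" by blast
  show ?thesis
  proof (intro exI[of _ "\<omega> ` {..<T}"] conjI ballI)
    show "\<omega> ` {..<T} \<subseteq> L" using \<omega>(1) by auto
    show "\<omega> ` {..<T} \<inter> \<alpha> i \<noteq> {}" if "i \<in> I" for i
      using \<omega>(1) \<omega>(2)[OF that] unfolding A_def by (auto simp: PiE_iff)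
    show "\<exists>s<q. \<omega> ` {..<T} \<inter> \<beta> j s = {}" if "j \<in> J" for j
      using \<omega>(1) \<omega>(3)[OF that] unfolding B_def by auto
  qed
qed

section \<open>Halves with small intersections\<close>

text \<open>Each residue occurs once in each of the \<open>n div p\<close> full blocks of length
  \<open>p\<close>.\<close>

lemma card_residues_ge:
  fixes p n :: nat
  assumes "R \<subseteq> {..<p}" "p > 0"
  shows "card R * (n div p) \<le> card {x. x < n \<and> x mod p \<in> R}"
proof -
  let ?f = "\<lambda>(r, m). m * p + r"
  have "inj_on ?f (R \<times> {..<n div p})"
  proof (rule inj_onI, clarify)
    fix r m r' m' assume r: "r \<in> R" "r' \<in> R" and eq: "m * p + r = m' * p + r'"
    have "r < p" "r' < p" using r assms by auto
    then have "r = r'" using arg_cong[OF eq, of "\<lambda>x. x mod p"] by simp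
    then show "r = r' \<and> m = m'" using eq assms(2) by simp
  qed
  moreover have "?f ` (R \<times> {..<n div p}) \<subseteq> {x. x < n \<and> x mod p \<in> R}"
  proof clarify
    fix r m assume r: "r \<in> R" and m: "m < n div p"
    have rp: "r < p" using r assms by auto
    have "m * p + r < Suc m * p" using rp by simp
    also have "\<dots> \<le> n div p * p" using m by (intro mult_le_mono1) simp
    also have "\<dots> \<le> n" by simp
    finally show "m * p + r < n \<and> (m * p + r) mod p \<in> R" using r rp by simp
  qed
  ultimately have "card (R \<times> {..<n div p}) \<le> card {x. x < n \<and> x mod p \<in> R}"
    by (intro card_inj_on_le) auto
  then show ?thesis by (simp add: card_cartesian_product)
qed

text \<open>Each residue occurs at most once per block, and the incomplete block adds one to the
  number of blocks.\<close>

lemma card_residues_le: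
  fixes p n :: nat
  assumes "R \<subseteq> {..<p}"
  shows "card {x. x < n \<and> x mod p \<in> R} \<le> card R * (n div p + 1)"
proof -
  let ?f = "\<lambda>x. (x mod p, x div p)"
  have "inj_on ?f {x. x < n \<and> x mod p \<in> R}"
    by (rule inj_onI) (metis div_mult_mod_eq prod.inject)
  moreover have "?f ` {x. x < n \<and> x mod p \<in> R} \<subseteq> R \<times> {..n div p}"
    by (auto intro: div_le_mono)
  moreover have "finite R" using assms finite_subset by blast
  ultimately have "card {x. x < n \<and> x mod p \<in> R} \<le> card (R \<times> {..n div p})"
    by (intro card_inj_on_le) auto
  then show ?thesis by (simp add: card_cartesian_product)
qed

lemma card_supersets:
  assumes "finite Q" "P \<subseteq> Q"
  shows "card {S. P \<subseteq> S \<and> S \<subseteq> Q} = 2 ^ (card Q - card P)"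
proof -
  have "bij_betw (\<lambda>S. S - P) {S. P \<subseteq> S \<and> S \<subseteq> Q} (Pow (Q - P))"
    by (rule bij_betw_byWitness[where f' = "\<lambda>S. S \<union> P"]) (use assms in auto)
  then show ?thesis using assms
    by (simp add: bij_betw_same_card card_Pow card_Diff_subset finite_subset)
qed

text \<open>Split the points evenly into \<open>2 ^ q\<close> classes labelled by the subsets of \<open>{..<q}\<close>; the
  \<open>i\<close>-th half consists of the classes whose label contains \<open>i\<close>.\<close>

lemma halves_initial:
  fixes n q :: nat
  assumes "q \<ge> 2"
  shows "\<exists>B. \<forall>i<q. B i \<subseteq> {..<n} \<and> n \<le> 2 * card (B i) + 2 ^ q \<and>
    (\<forall>j<q. i \<noteq> j \<longrightarrow> 4 * card (B i \<inter> B j) \<le> n + 2 ^ q)"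
proof -
  define p :: nat where "p = 2 ^ q"
  have p: "p > 0" unfolding p_def by simp
  obtain r where r: "q = Suc (Suc r)" using assms by (metis add_2_eq_Suc le_Suc_ex)
  have "card (Pow {..<q}) = p" by (simp add: p_def card_Pow)
  then obtain e where e: "bij_betw e {0..<p} (Pow {..<q})"
    using ex_bij_betw_nat_finite[of "Pow {..<q}"] by auto
  \<comment> \<open>The classes whose label contains \<open>P\<close>: half of all for a singleton,
    a quarter for a pair.\<close>
  define R where "R P = {x \<in> {..<p}. P \<subseteq> e x}" for P
  have cardR: "card (R P) = 2 ^ (q - card P)" if "P \<subseteq> {..<q}" for P
  proof -
    have "e ` R P = {S \<in> e ` {0..<p}. P \<subseteq> S}" unfolding R_def by auto
    then have "e ` R P = {S. P \<subseteq> S \<and> S \<subseteq> {..<q}}" using bij_betw_imp_surj_on[OF e] by auto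
    moreover have "inj_on e (R P)"
      using bij_betw_imp_inj_on[OF e] by (rule inj_on_subset) (auto simp: R_def)
    ultimately show ?thesis using card_supersets[of "{..<q}" P] that card_image[of e "R P"] by simp
  qed
  have Rp: "R P \<subseteq> {..<p}" for P by (auto simp: R_def)
  define B where "B i = {x. x < n \<and> x mod p \<in> R {i}}" for i
  have np: "n \<le> p * (n div p) + p"
    using mod_less_divisor[OF p, of n] mult_div_mod_eq[of p n] by linarith
  have np': "p * (n div p) \<le> n" by simp
  have "n \<le> 2 * card (B i) + 2 ^ q" if "i < q" for i
    using card_residues_ge[OF Rp p, of "{i}" n] cardR[of "{i}"] that np r
    unfolding B_def p_def by simp
  moreover have "4 * card (B i \<inter> B j) \<le> n + 2 ^ q" if "i < q" "j < q" "i \<noteq> j" for i j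
  proof -
    have "B i \<inter> B j = {x. x < n \<and> x mod p \<in> R {i, j}}" unfolding B_def R_def by auto
    then have "card (B i \<inter> B j) \<le> 2 ^ r * (n div p + 1)"
      using card_residues_le[OF Rp, of n "{i, j}"] cardR[of "{i, j}"] that r by simp
    then have "4 * card (B i \<inter> B j) \<le> p * (n div p) + p" unfolding p_def r by simp
    then show ?thesis using np' unfolding p_def by linarith
  qed
  ultimately show ?thesis by (intro exI[of _ B]) (auto simp: B_def)
qed

text \<open>The spare \<open>2 ^ q\<close> points allow each half to be cut down to exactly
  \<open>l\<close> points, which only shrinks intersections; a bijection then moves them into
  \<open>X\<close>.\<close>

lemma halves:
  fixes q l :: nat
  assumes "q \<ge> 2" "finite X" "2 * l + 2 ^ q \<le> card X"
  shows "\<exists>B. \<forall>i<q. B i \<subseteq> X \<and> card (B i) = l \<and>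
    (\<forall>j<q. i \<noteq> j \<longrightarrow> 4 * card (B i \<inter> B j) \<le> card X + 2 ^ q)"
proof -
  define n where "n = card X"
  obtain B0 where B0: "\<And>i. i < q \<Longrightarrow> B0 i \<subseteq> {..<n}" "\<And>i. i < q \<Longrightarrow> n \<le> 2 * card (B0 i) + 2 ^ q"
    "\<And>i j. i < q \<Longrightarrow> j < q \<Longrightarrow> i \<noteq> j \<Longrightarrow> 4 * card (B0 i \<inter> B0 j) \<le> n + 2 ^ q"
    using halves_initial[OF assms(1), of n] by blast
  have "\<exists>B. B \<subseteq> B0 i \<and> card B = l" if "i < q" for i
    using obtain_subset_with_card_n[of l "B0 i"] B0(2)[OF that] assms(3) unfolding n_def by auto
  then obtain B1 where B1: "\<And>i. i < q \<Longrightarrow> B1 i \<subseteq> B0 i" "\<And>i. i < q \<Longrightarrow> card (B1 i) = l" by metis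
  obtain e where e: "bij_betw e {0..<n} X" using ex_bij_betw_nat_finite[OF assms(2)] n_def by auto
  have inj: "inj_on e {..<n}" and im: "e ` {..<n} = X"
    using e unfolding bij_betw_def lessThan_atLeast0 by auto
  have B1n: "B1 i \<subseteq> {..<n}" if "i < q" for i using B0(1) B1(1) that by blast
  show ?thesis
  proof (intro exI[of _ "\<lambda>i. e ` B1 i"] allI impI conjI)
    fix i assume i: "i < q"
    show "e ` B1 i \<subseteq> X" using B1n[OF i] im by blast
    show "card (e ` B1 i) = l" using card_image[OF inj_on_subset[OF inj B1n[OF i]]] B1(2)[OF i] by simp
    fix j assume j: "j < q" "i \<noteq> j"
    have "e ` B1 i \<inter> e ` B1 j = e ` (B1 i \<inter> B1 j)"
      using inj_on_image_Int[OF inj B1n[OF i] B1n[OF j(1)]] by simp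
    then have "card (e ` B1 i \<inter> e ` B1 j) \<le> card (B1 i \<inter> B1 j)"
      using finite_subset[OF B1n[OF i]] by (simp add: card_image_le)
    also have "\<dots> \<le> card (B0 i \<inter> B0 j)"
      using B1(1)[OF i] B1(1)[OF j(1)] finite_subset[OF B0(1)[OF i]] by (intro card_mono) auto
    finally show "4 * card (e ` B1 i \<inter> e ` B1 j) \<le> card X + 2 ^ q"
      using B0(3)[OF i j] unfolding n_def by linarith
  qed
qed

section \<open>Lower bound for long chains\<close>

text \<open>Removing \<open>K\<close> is injective. For \<open>m < card K\<close> there are no such
  sets while truncated subtraction makes the right side 1, hence an inequality.\<close>

lemma card_supersets_of_size:
  assumes "finite V" "K \<subseteq> V"
  shows "card {H. K \<subseteq> H \<and> H \<subseteq> V \<and> card H = m} \<le> (card V - card K) choose (m - card K)"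
proof -
  have finK: "finite K" using assms finite_subset by blast
  have "inj_on (\<lambda>H. H - K) {H. K \<subseteq> H \<and> H \<subseteq> V \<and> card H = m}"
    by (rule inj_onI) blast
  moreover have "(\<lambda>H. H - K) ` {H. K \<subseteq> H \<and> H \<subseteq> V \<and> card H = m} \<subseteq> {S. S \<subseteq> V - K \<and> card S = m - card K}"
    using finK by (auto simp: card_Diff_subset)
  moreover have "finite {S. S \<subseteq> V - K \<and> card S = m - card K}" using assms(1) by simp
  ultimately have "card {H. K \<subseteq> H \<and> H \<subseteq> V \<and> card H = m} \<le> card {S. S \<subseteq> V - K \<and> card S = m - card K}"
    by (intro card_inj_on_le)
  also have "\<dots> = (card V - card K) choose (m - card K)"
    using assms finK by (simp add: n_subsets card_Diff_subset)
  finally show ?thesis .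
qed

text \<open>\<open>random_family\<close> is applied to the \<open>M\<close>-subsets of an
  \<open>N\<close>-set. The first condition on \<open>l\<close> yields \<open>q\<close> near-halves
  of \<open>X\<close> of size \<open>l\<close>; the second makes \<open>F\<close> with two of them
  larger than \<open>M\<close>, which gives the disjointness required there. In
  \<open>bound\<close>, \<open>4 ^ N\<close> counts all pairs of subsets.\<close>

lemma cover_and_avoid:
  fixes n l q N M T :: nat
  assumes q: "q \<ge> 2" and M: "N = n + M" "n \<le> M"
    and l: "2 * l + 2 ^ q \<le> n" "4 * M + n + 2 ^ q < 4 * (n + l)"
    and bound: "4 ^ N * (1 - real (n choose l) / (N choose M)) ^ T
      + 4 ^ N * (T * real (M choose n) / (N choose M)) ^ q < 1"
  shows "\<exists>\<H>.
    (\<forall>X W. X \<subseteq> {0..<N} \<longrightarrow> card X = n \<longrightarrow> W \<subseteq> {0..<N} - X \<longrightarrow> card W = N - n - (n - l)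
      \<longrightarrow> (\<exists>F\<subseteq>X. card F = n - l \<and> F \<union> W \<in> \<H>)) \<and>
    (\<forall>X F. X \<subseteq> {0..<N} \<longrightarrow> card X = n \<longrightarrow> F \<subseteq> {0..<N} - X \<longrightarrow> card F = n - l
      \<longrightarrow> (\<exists>B\<subseteq>X. card B = l \<and> (\<forall>H\<in>\<H>. \<not> F \<union> B \<subseteq> H)))"
proof -
  define V where "V = {0..<N}"
  have V: "finite V" "card V = N" by (simp_all add: V_def)
  define k where "k = n - l"
  have k: "k + l = n" "k \<le> M" using l M unfolding k_def by auto
  define L where "L = {H. H \<subseteq> V \<and> card H = M}"
  have finL: "finite L" and cardL: "card L = N choose M" using V n_subsets[of V M] unfolding L_def by auto
  have finS: "finite S" if "S \<subseteq> V" for S using that V finite_subset by blast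
  define I where "I = {(X, W). X \<subseteq> V \<and> card X = n \<and> W \<subseteq> V - X \<and> card W = M - k}"
  define J where "J = {(X, F). X \<subseteq> V \<and> card X = n \<and> F \<subseteq> V - X \<and> card F = k}"
  have pairs: "finite P \<and> card P \<le> 4 ^ N" if "P \<subseteq> Pow V \<times> Pow V" for P
  proof -
    have "card (Pow V \<times> Pow V) = 4 ^ N"
      using V by (simp add: card_cartesian_product card_Pow power_mult_distrib[symmetric])
    then show ?thesis using that V card_mono[OF _ that] finite_subset[OF that] by simp
  qed
  have I: "finite I" "card I \<le> 4 ^ N" using pairs[of I] unfolding I_def by auto
  have J: "finite J" "card J \<le> 4 ^ N" using pairs[of J] unfolding J_def by auto
  define \<alpha> where "\<alpha> = (\<lambda>(X :: nat set, W :: nat set). (\<lambda>F. F \<union> W) ` {F. F \<subseteq> X \<and> card F = k})"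
  have \<alpha>: "\<alpha> (X, W) \<subseteq> L \<and> n choose l \<le> card (\<alpha> (X, W))" if "(X, W) \<in> I" for X W
  proof -
    have XW: "X \<subseteq> V" "card X = n" "W \<subseteq> V - X" "card W = M - k" using that unfolding I_def by auto
    have "card (F \<union> W) = M" if F: "F \<subseteq> X" "card F = k" for F
    proof -
      have "card (F \<union> W) = card F + card W"
        by (rule card_Un_disjoint) (use F XW finS[of F] finS[of W] in auto)
      then show ?thesis using F XW k by simp
    qed
    then have "\<alpha> (X, W) \<subseteq> L" using XW unfolding \<alpha>_def L_def by auto
    moreover have "inj_on (\<lambda>F. F \<union> W) {F. F \<subseteq> X \<and> card F = k}"
    proof (rule inj_onI)
      fix F F' assume "F \<in> {F. F \<subseteq> X \<and> card F = k}" "F' \<in> {F. F \<subseteq> X \<and> card F = k}" "F \<union> W = F' \<union> W"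
      then show "F = F'" using XW(3) by blast
    qed
    then have "card (\<alpha> (X, W)) = n choose k"
      using n_subsets[OF finS[OF XW(1)], of k] XW(2) unfolding \<alpha>_def by (simp add: card_image)
    moreover have "n choose k = n choose l" using binomial_symmetric[of l n] k by (simp add: k_def)
    ultimately show ?thesis by simp
  qed
  define good where "good X B \<longleftrightarrow> (\<forall>i<q. B i \<subseteq> X \<and> card (B i) = l \<and>
    (\<forall>j<q. i \<noteq> j \<longrightarrow> 4 * card (B i \<inter> B j) \<le> n + 2 ^ q))" for X :: "nat set" and B
  define Bf where "Bf X = (SOME B. good X B)" for X
  have Bf: "good X (Bf X)" if "X \<subseteq> V" "card X = n" for X
  proof -
    have "\<exists>B. good X B"
      using halves[OF q finS[OF that(1)], of l] l(1) that(2) unfolding good_def by simp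
    then show ?thesis unfolding Bf_def by (rule someI_ex)
  qed
  \<comment> \<open>The samples that would spoil the \<open>s\<close>-th candidate for
    \<open>B\<close>.\<close>
  define \<beta> where "\<beta> = (\<lambda>(X :: nat set, F) s. {H \<in> L. F \<union> Bf X s \<subseteq> H})"
  have \<beta>: "card (\<beta> (X, F) s) \<le> M choose n" if "(X, F) \<in> J" "s < q" for X F s
  proof -
    have XF: "X \<subseteq> V" "card X = n" "F \<subseteq> V - X" "card F = k" using that unfolding J_def by auto
    have B: "Bf X s \<subseteq> X" "card (Bf X s) = l" using Bf[OF XF(1,2)] that(2) unfolding good_def by auto
    have sub: "F \<union> Bf X s \<subseteq> V" using B XF by auto
    have "card (F \<union> Bf X s) = card F + card (Bf X s)"
      by (rule card_Un_disjoint) (use B XF finS[of F] finS[of "Bf X s"] in auto)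
    then have "card (F \<union> Bf X s) = n" using B XF k by simp
    moreover have "\<beta> (X, F) s = {H. F \<union> Bf X s \<subseteq> H \<and> H \<subseteq> V \<and> card H = M}"
      unfolding \<beta>_def L_def by auto
    ultimately have "card (\<beta> (X, F) s) \<le> M choose (M - n)"
      using card_supersets_of_size[OF V(1) sub, of M] V(2) M(1) by simp
    then show ?thesis using binomial_symmetric[OF M(2)] by simp
  qed
  have dis: "disjoint_family_on (\<beta> (X, F)) {..<q}" if "(X, F) \<in> J" for X F
    unfolding disjoint_family_on_def
  proof (intro ballI impI equals0I)
    fix i j H assume ij: "i \<in> {..<q}" "j \<in> {..<q}" "i \<noteq> j" and H: "H \<in> \<beta> (X, F) i \<inter> \<beta> (X, F) j"
    have XF: "X \<subseteq> V" "card X = n" "F \<subseteq> V - X" "card F = k" using that unfolding J_def by auto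
    let ?A = "Bf X i" and ?B = "Bf X j"
    have B: "?A \<subseteq> X" "?B \<subseteq> X" "card ?A = l" "card ?B = l" "4 * card (?A \<inter> ?B) \<le> n + 2 ^ q"
      using Bf[OF XF(1,2)] ij unfolding good_def by auto
    have fin: "finite ?A" "finite ?B" "finite F" using B XF finS[of ?A] finS[of ?B] finS[of F] by auto
    have "H \<subseteq> V" "card H = M" "F \<union> (?A \<union> ?B) \<subseteq> H" using H unfolding \<beta>_def L_def by auto
    then have "card (F \<union> (?A \<union> ?B)) \<le> M" using card_mono finS by metis
    moreover have "card (F \<union> (?A \<union> ?B)) = k + card (?A \<union> ?B)"
      using card_Un_disjoint[of F "?A \<union> ?B"] fin B XF by auto
    moreover have "card ?A + card ?B = card (?A \<union> ?B) + card (?A \<inter> ?B)"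
      by (rule card_Un_Int[OF fin(1,2)])
    ultimately have "n + l \<le> M + card (?A \<inter> ?B)" using B(3,4) k(1) by linarith
    then have "4 * (n + l) \<le> 4 * M + 4 * card (?A \<inter> ?B)" by simp
    also have "\<dots> \<le> 4 * M + n + 2 ^ q" using B(5) by simp
    finally show False using l(2) by simp
  qed
  \<comment> \<open>Any single member of \<open>I\<close> shows that \<open>L\<close> contains at
    least \<open>n choose l\<close> sets.\<close>
  have lk: "n choose l \<le> N choose M"
  proof -
    have "({0..<n}, {n..<n + (M - k)}) \<in> I" using M unfolding I_def V_def by auto
    from \<alpha>[OF this] show ?thesis using card_mono[OF finL] cardL order_trans by metis
  qed
  have "real (card I) * (1 - real (n choose l) / card L) ^ T + real (card J) * (T * real (M choose n) / card L) ^ q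
      \<le> 4 ^ N * (1 - real (n choose l) / card L) ^ T + 4 ^ N * (T * real (M choose n) / card L) ^ q"
  proof (intro add_mono mult_right_mono)
    show "real (card I) \<le> 4 ^ N" "real (card J) \<le> 4 ^ N"
      using I(2) J(2) by (metis of_nat_le_iff of_nat_numeral of_nat_power)+
    have "real (n choose l) / card L \<le> 1"
      using lk unfolding cardL by (simp add: divide_le_eq)
    then show "0 \<le> (1 - real (n choose l) / card L) ^ T" by simp
  qed simp
  also have "\<dots> < 1" using bound unfolding cardL .
  finally have b: "real (card I) * (1 - real (n choose l) / card L) ^ T
    + real (card J) * (T * real (M choose n) / card L) ^ q < 1" .
  have "L \<noteq> {}" using cardL M by auto
  then obtain \<H> where \<H>: "\<H> \<subseteq> L" "\<And>i. i \<in> I \<Longrightarrow> \<H> \<inter> \<alpha> i \<noteq> {}" "\<And>j. j \<in> J \<Longrightarrow> \<exists>s<q. \<H> \<inter> \<beta> j s = {}"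
  proof -
    have "\<exists>\<H>\<subseteq>L. (\<forall>i\<in>I. \<H> \<inter> \<alpha> i \<noteq> {}) \<and> (\<forall>j\<in>J. \<exists>s<q. \<H> \<inter> \<beta> j s = {})"
    proof (rule random_family[where a = "n choose l" and b = "M choose n" and T = T])
      fix j s assume "j \<in> J" "s < q"
      then show "\<beta> j s \<subseteq> L" "card (\<beta> j s) \<le> M choose n"
        using \<beta> by (cases j, auto simp: \<beta>_def)+
    qed (use finL \<open>L \<noteq> {}\<close> I(1) J(1) \<alpha> dis lk b cardL in auto)
    then show ?thesis using that by blast
  qed
  show ?thesis
  proof (intro exI[of _ \<H>] conjI allI impI)
    fix X W assume "X \<subseteq> {0..<N}" "card X = n" "W \<subseteq> {0..<N} - X" "card W = N - n - (n - l)"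
    then have "(X, W) \<in> I" using M unfolding I_def V_def k_def by simp
    from \<H>(2)[OF this] show "\<exists>F\<subseteq>X. card F = n - l \<and> F \<union> W \<in> \<H>"
      unfolding \<alpha>_def k_def by blast
  next
    fix X F assume XF: "X \<subseteq> {0..<N}" "card X = n" "F \<subseteq> {0..<N} - X" "card F = n - l"
    then have "(X, F) \<in> J" unfolding J_def V_def k_def by simp
    from \<H>(3)[OF this] obtain s where s: "s < q" "\<H> \<inter> \<beta> (X, F) s = {}" by blast
    have "Bf X s \<subseteq> X" "card (Bf X s) = l" using Bf[of X] XF s(1) unfolding good_def V_def by auto
    moreover have "\<forall>H\<in>\<H>. \<not> F \<union> Bf X s \<subseteq> H"
    proof (intro ballI notI)
      fix H assume H: "H \<in> \<H>" "F \<union> Bf X s \<subseteq> H"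
      then have "H \<in> \<beta> (X, F) s" using \<H>(1) unfolding \<beta>_def by auto
      then show False using s(2) H(1) by auto
    qed
    ultimately show "\<exists>B\<subseteq>X. card B = l \<and> (\<forall>H\<in>\<H>. \<not> F \<union> B \<subseteq> H)"
      by (intro exI[of _ "Bf X s"] conjI)
  qed
qed

lemma EH_chain_greater_of_bound:
  fixes n l q M T t :: nat
  assumes "t \<ge> 4" "q \<ge> 2" "n \<le> M"
    and "2 * l + 2 ^ q \<le> n" "4 * M + n + 2 ^ q < 4 * (n + l)"
    and "4 ^ (n + M) * (1 - real (n choose l) / (n + M choose M)) ^ T
      + 4 ^ (n + M) * (T * real (M choose n) / (n + M choose M)) ^ q < 1"
  shows "n + M < EH_chain t n"
proof -
  have l: "n - (n - l) = l" using assms(4) by simp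
  obtain \<H> where
    "\<And>X W. X \<subseteq> {0..<n + M} \<Longrightarrow> card X = n \<Longrightarrow> W \<subseteq> {0..<n + M} - X \<Longrightarrow> card W = n + M - n - (n - l)
      \<Longrightarrow> \<exists>F\<subseteq>X. card F = n - l \<and> F \<union> W \<in> \<H>"
    "\<And>X F. X \<subseteq> {0..<n + M} \<Longrightarrow> card X = n \<Longrightarrow> F \<subseteq> {0..<n + M} - X \<Longrightarrow> card F = n - l
      \<Longrightarrow> \<exists>B\<subseteq>X. card B = n - (n - l) \<and> (\<forall>H\<in>\<H>. \<not> F \<union> B \<subseteq> H)"
    using cover_and_avoid[OF assms(2) refl assms(3-6)] unfolding l by blast
  then have "\<not> has_mono_Q n (layered (n - l) (n + M - (n - l)) \<H>) (n + M)"
    using assms(3) by (intro layered_no_mono_Q) auto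
  moreover have "\<not> has_rbr_chain t (layered (n - l) (n + M - (n - l)) \<H>) (n + M)"
    using assms(1) by (rule layered_no_chain)
  ultimately show ?thesis using assms(1) by (intro EH_chain_greater) auto
qed

section \<open>Numerical estimates and choice of parameters\<close>

text \<open>So many samples push the miss probability to at most \<open>exp (- 2 * N)\<close>, which
  is at most \<open>(1 / 5) ^ N\<close>; and \<open>(4 / 5) ^ 4 < 1 / 2\<close>.\<close>

lemma four_power_times_miss_le:
  fixes a D N T :: nat
  assumes "0 < a" "a \<le> D" "2 * real N * D / a \<le> T" "4 \<le> N"
  shows "4 ^ N * (1 - real a / D) ^ T < 1 / 2"
proof -
  have "(1 - real a / D) ^ T \<le> exp (- (real a / D)) ^ T"
    using exp_ge_add_one_self[of "- (real a / D)"] assms(1,2) by (intro power_mono) (auto simp: field_simps)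
  also have "\<dots> = exp (- (real a / D * T))" by (simp add: exp_of_nat_mult[symmetric])
  also have "\<dots> \<le> exp (- (2 * real N))"
    using assms by (simp add: field_simps)
  also have "\<dots> = exp (- 2) ^ N" by (simp add: exp_of_nat_mult[symmetric] mult.commute)
  also have "\<dots> \<le> (1 / 5) ^ N"
  proof (rule power_mono)
    have "5 \<le> exp (2 :: real)" using exp_lower_Taylor_quadratic[of 2] by simp
    then show "exp (- 2 :: real) \<le> 1 / 5" by (simp add: exp_minus field_simps)
  qed simp
  finally have "4 ^ N * (1 - real a / D) ^ T \<le> 4 ^ N * (1 / 5) ^ N" by simp
  also have "\<dots> = (4 / 5) ^ N" by (simp add: power_mult_distrib[symmetric])
  also have "\<dots> \<le> (4 / 5 :: real) ^ 4" by (rule power_decreasing) (use assms(4) in auto)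
  also have "\<dots> < 1 / 2" by (simp add: power4_eq_xxxx)
  finally show ?thesis .
qed

text \<open>A single term of the expansion of \<open>(4 + 1) ^ M\<close>. The weight 4 suits
  \<open>n / M\<close> near \<open>1 / 1.24\<close>, about 0.81, as the largest terms sit near
  \<open>4 / 5\<close> of \<open>M\<close>.\<close>

lemma choose_mult_four_power_le:
  assumes "n \<le> M"
  shows "(M choose n) * 4 ^ n \<le> 5 ^ M"
proof -
  have "(M choose n) * 4 ^ n * 1 ^ (M - n) \<le> (\<Sum>k\<le>M. (M choose k) * 4 ^ k * 1 ^ (M - k))"
    using assms by (intro member_le_sum) auto
  also have "\<dots> = (4 + 1) ^ M" by (simp only: binomial of_nat_id)
  finally show ?thesis by simp
qed

text \<open>Rests on \<open>5 ^ 31 \<le> 4 ^ 36\<close>, with \<open>1.24 = 31 * 0.04\<close> and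
  \<open>1.44 = 36 * 0.04\<close>.\<close>

lemma five_powr_le:
  assumes "x \<le> 1.24 * n" "0 \<le> n"
  shows "(5 :: real) powr x \<le> 4 powr (1.44 * n)"
proof -
  have "(5 :: real) powr x \<le> 5 powr (31 * (0.04 * n))" using assms by simp
  also have "\<dots> = (5 powr 31) powr (0.04 * n)" by (simp only: powr_powr)
  also have "\<dots> \<le> (4 powr 36) powr (0.04 * n)" by (rule powr_mono2) (use assms(2) in auto)
  also have "\<dots> = 4 powr (36 * (0.04 * n))" by (simp only: powr_powr)
  finally show ?thesis by simp
qed

text \<open>The numerator is at most \<open>4 powr (0.44 * n)\<close>. The denominator is at least
  the central coefficient of \<open>2 * l\<close>, hence at least
  \<open>4 powr (0.495 * n - 1) / n\<close>.\<close>

lemma choose_ratio_le: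
  fixes n l M :: nat
  assumes "0 < l" "2 * l \<le> n" "n \<le> M" "real M \<le> 1.24 * n" "0.495 * n - 1 \<le> l"
  shows "real (M choose n) / (n choose l) \<le> n * 4 powr (1 - 0.055 * n)"
proof -
  have "real ((M choose n) * 4 ^ n) \<le> real (5 ^ M)"
    using choose_mult_four_power_le[OF assms(3)] by (rule of_nat_mono)
  then have "real (M choose n) * 4 powr n \<le> 5 powr M" by (simp add: powr_realpow)
  also have "\<dots> \<le> 4 powr (1.44 * n)" using assms(4) by (intro five_powr_le) auto
  finally have b: "real (M choose n) \<le> 4 powr (0.44 * n)"
    using powr_add[of 4 "0.44 * n" n] by (simp add: algebra_simps)
  have "4 powr (0.495 * n - 1) \<le> 4 powr real l" using assms(5) by simp
  also have "\<dots> = 4 ^ l" by (simp add: powr_realpow)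
  also have "\<dots> \<le> 2 * l * real ((2 * l) choose l)"
    using central_binomial_lower_bound[OF assms(1)] assms(1) by (simp add: field_simps)
  also have "\<dots> \<le> n * real (n choose l)"
    using assms(2) by (intro mult_mono of_nat_mono binomial_right_mono) auto
  finally have a: "4 powr (0.495 * n - 1) \<le> n * real (n choose l)" .
  have pos: "0 < real (n choose l)" using assms(2) by simp
  have "real (M choose n) \<le> 4 powr (1 - 0.055 * n) * 4 powr (0.495 * n - 1)"
    using b by (simp add: powr_add[symmetric])
  also have "\<dots> \<le> 4 powr (1 - 0.055 * n) * (n * real (n choose l))" using a by simp
  finally show ?thesis using pos by (simp add: field_simps)
qed

lemma eventually_EH_chain_greater:
  assumes "t \<ge> 4"
  shows "\<forall>\<^sub>F n in sequentially. 2.24 * real n < EH_chain t n"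
proof -
  \<comment> \<open>Absorbs the polynomial factor while the decay rate drops from 0.055 to
    0.05.\<close>
  have "\<forall>\<^sub>F n :: nat in sequentially. 28 * real n ^ 2 * 4 powr (- 0.005 * n) \<le> 1"
    by real_asymp
  moreover have "\<forall>\<^sub>F n :: nat in sequentially. n \<ge> 2 ^ 60" by (rule eventually_ge_at_top)
  ultimately show ?thesis
  proof eventually_elim
    case (elim n)
    define N where "N = 224 * n div 100"
    define M where "M = N - n"
    \<comment> \<open>Up to constants, \<open>M \<le> 1.24 * n\<close> leaves for \<open>l\<close>
      the range from \<open>0.49 * n\<close> to \<open>0.5 * n\<close>; its midpoint is taken. The
      slack of order \<open>n / 100\<close> exceeds \<open>2 ^ 50\<close> because
      \<open>n \<ge> 2 ^ 60\<close>.\<close>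
    define l where "l = 99 * n div 200"
    define a where "a = n choose l"
    define b where "b = M choose n"
    define D where "D = N choose M"
    define T where "T = nat \<lceil>2 * real N * D / a\<rceil>"
    have NM: "N = n + M" "n \<le> M" using elim(2) unfolding N_def M_def by auto
    have "100 * N \<le> 224 * n" "224 * n < 100 * N + 100" unfolding N_def by simp_all
    then have "real (100 * N) \<le> real (224 * n)" "real (224 * n) < real (100 * N + 100)"
      by (simp_all only: of_nat_le_iff of_nat_less_iff)
    then have N': "real N \<le> 2.24 * n" "2.24 * n < real N + 1" by simp_all
    have M: "real M \<le> 1.24 * n" using NM(1) N'(1) by simp
    have "200 * l \<le> 99 * n" "99 * n < 200 * l + 200" unfolding l_def by simp_all
    then have "real (200 * l) \<le> real (99 * n)" "real (99 * n) < real (200 * l + 200)"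
      by (simp_all only: of_nat_le_iff of_nat_less_iff)
    then have l': "real l \<le> 0.495 * n" "0.495 * real n - 1 \<le> l" by simp_all
    have big: "2 ^ 60 \<le> real n" using elim(2) by (simp add: numeral_power_le_of_nat_cancel_iff)
    have "real (2 * l + 2 ^ 50) \<le> real n" using l'(1) big by simp
    then have l3: "2 * l + 2 ^ 50 \<le> n" by (simp only: of_nat_le_iff)
    have "real (4 * M + n + 2 ^ 50) < real (4 * (n + l))" using M l'(2) big by simp
    then have l4: "4 * M + n + 2 ^ 50 < 4 * (n + l)" by (simp only: of_nat_less_iff)
    have l: "2 * l \<le> n" "0 < l" using l3 l'(2) big by auto
    have "a \<le> D"
    proof -
      have "a \<le> N choose l" unfolding a_def using NM by (intro binomial_right_mono) simp
      also have "\<dots> \<le> N choose n" using NM l(1) by (intro binomial_mono) auto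
      also have "\<dots> = D" unfolding D_def using binomial_symmetric[of n N] NM by simp
      finally show ?thesis .
    qed
    have a: "0 < a" unfolding a_def using l(1) by simp
    have N: "4 \<le> N" using NM elim(2) by simp
    have miss: "4 ^ N * (1 - real a / D) ^ T < 1 / 2"
      using a \<open>a \<le> D\<close> N unfolding T_def by (intro four_power_times_miss_le) linarith+
    have "0 \<le> 2 * real N * D / a" by simp
    then have "real T \<le> 2 * real N * D / a + 1" unfolding T_def by linarith
    \<comment> \<open>Rounding \<open>T\<close> up costs 1, which turns the factor 2 into 3.\<close>
    also have "1 \<le> real N * (D / a)" using a \<open>a \<le> D\<close> N mult_mono[of 1 "real N" 1 "D / a"] by simp
    finally have "real T \<le> 3 * real N * D / a" by (simp add: mult.commute mult.left_commute)
    then have "T * real b / D \<le> (3 * real N * D / a) * real b / D" by (intro divide_right_mono mult_right_mono) auto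
    also have "\<dots> = 3 * real N * (b / a)" using a \<open>a \<le> D\<close> by simp
    also have "\<dots> \<le> 3 * (2.24 * n) * (n * 4 powr (1 - 0.055 * n))"
      using N'(1) choose_ratio_le[OF l(2,1) NM(2) M l'(2)] unfolding a_def b_def by (intro mult_mono) auto
    also have "\<dots> \<le> 28 * real n ^ 2 * 4 powr (- 0.055 * n)"
    proof -
      have "4 powr (1 - 0.055 * n) = 4 * 4 powr (- 0.055 * n)"
        using powr_add[of 4 1 "- 0.055 * n"] by simp
      then have "3 * (2.24 * n) * (n * 4 powr (1 - 0.055 * n)) = 26.88 * (real n ^ 2 * 4 powr (- 0.055 * n))"
        by (simp add: power2_eq_square)
      also have "\<dots> \<le> 28 * (real n ^ 2 * 4 powr (- 0.055 * n))" by (intro mult_right_mono) auto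
      finally show ?thesis by (simp only: mult.assoc)
    qed
    also have "\<dots> = (28 * real n ^ 2 * 4 powr (- 0.005 * n)) * 4 powr (- 0.05 * n)"
      by (simp add: powr_add[symmetric])
    also have "\<dots> \<le> 1 * 4 powr (- 0.05 * n)" by (intro mult_right_mono elim(1)) simp
    \<comment> \<open>Fifty disjoint events give the exponent \<open>2.5 * n\<close>, which beats
      the at most \<open>2.24 * n\<close> from \<open>4 ^ N\<close>.\<close>
    finally have "(T * real b / D) ^ 50 \<le> (4 powr (- 0.05 * n)) ^ 50" by (intro power_mono) auto
    also have "\<dots> = 4 powr (- 2.5 * n)" by (simp add: powr_realpow[symmetric] powr_powr)
    finally have "4 ^ N * (T * real b / D) ^ 50 \<le> 4 powr N * 4 powr (- 2.5 * n)"
      by (simp add: powr_realpow)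
    also have "\<dots> = 4 powr (N - 2.5 * n)" by (simp add: powr_add[symmetric])
    also have "\<dots> \<le> 4 powr (- 1)" using N'(1) big by (intro powr_mono) auto
    also have "\<dots> < 1 / 2" by (simp add: powr_minus)
    finally have "4 ^ N * (1 - real a / D) ^ T + 4 ^ N * (T * real b / D) ^ 50 < 1" using miss by linarith
    then have "N < EH_chain t n"
      using EH_chain_greater_of_bound[OF assms, of 50 n M l T] NM l3 l4 unfolding a_def b_def D_def by simp
    \<comment> \<open>\<open>N\<close> is rounded down, so the strict inequality is what carries the
      bound past \<open>2.24 * n\<close>.\<close>
    then have "N + 1 \<le> EH_chain t n" by simp
    then have "real N + 1 \<le> EH_chain t n" by linarith
    then show ?case using N'(2) by linarith
  qed
qed

theorem theorem5:
  shows "(\<forall>n::nat. n \<ge> 1 \<longrightarrow> EH_chain 2 n = 2 * n \<and> EH_chain 3 n = 2 * n)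
       \<and> (\<forall>t::nat. t \<ge> 4 \<longrightarrow> (\<exists>n0::nat. \<forall>n\<ge>n0.
            (224 / 100 :: real) * real n < real (EH_chain t n)
            \<and> EH_chain t n \<le> (t - 1) * n))"
proof (intro conjI allI impI)
  fix n :: nat assume "n \<ge> 1"
  \<comment> \<open>For \<open>t\<close> equal to 2 or 3, \<open>t div 2 + 1\<close> is 2 and the
    two bounds meet.\<close>
  then show "EH_chain 2 n = 2 * n" "EH_chain 3 n = 2 * n"
    using EH_chain_le[of 2 n] EH_chain_le[of 3 n] EH_chain_ge_double[of 2 n] EH_chain_ge_double[of 3 n]
    by simp_all
next
  fix t :: nat assume t: "t \<ge> 4"
  obtain n0 where n0: "\<And>n. n \<ge> n0 \<Longrightarrow> 2.24 * real n < EH_chain t n"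
    using eventually_EH_chain_greater[OF t] unfolding eventually_sequentially by blast
  have "t div 2 + 1 \<le> t - 1" using t by linarith
  then have le: "EH_chain t n \<le> (t - 1) * n" for n
    using EH_chain_le[of t n] t mult_le_mono1[of "t div 2 + 1" "t - 1" n] by linarith
  show "\<exists>n0. \<forall>n\<ge>n0. (224 / 100 :: real) * real n < real (EH_chain t n) \<and> EH_chain t n \<le> (t - 1) * n"
    using n0 le by (intro exI[of _ n0]) simp
qed

end
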